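(* For $n\ge1$ let $\mathcal{H}_n=\{S\subseteq \mathbb{F}_2^n : \exists\, v\in\mathbb{F}_2^n \text{ with } v^\perp\subseteq S\}$. Then $|\mathcal{H}_n| = (1+o(1))\,2^{2^{n-1}}(2^n-1)$ as $n\to\infty$.
   Context: $v^\perp=\{x\in\mathbb{F}_2^n : \langle x,v\rangle=0\}$ with the standard bilinear form $\langle x,v\rangle=\sum_i x_iv_i$ over $\mathbb{F}_2$. *)

theory Defs
  imports
    "HOL-Library.Z2"
    "HOL-Library.Landau_Symbols"
    "Jordan_Normal_Form.Matrix"
begin

text \<open>The field of two elements is \<^typ>\<open>bit\<close>, and \<open>\<F>\<^sub>2\<^sup>n\<close> is the set
  \<open>carrier_vec n\<close> of vectors of dimension \<open>n\<close> over it.\<close>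

definition perp :: "nat \<Rightarrow> bit vec \<Rightarrow> bit vec set" where
  "perp n v = {x \<in> carrier_vec n. x \<bullet> v = 0}"

definition \<H> :: "nat \<Rightarrow> bit vec set set" where
  "\<H> n = {S. S \<subseteq> carrier_vec n \<and> (\<exists>v \<in> carrier_vec n. perp n v \<subseteq> S)}"

end

theory Submission
  imports Defs
begin

text \<open>\<open>\<H> n\<close> is the union, over the \<open>2\<^sup>n - 1\<close> nonzero vectors \<open>v\<close>, of the
  families of supersets of \<open>v\<^sup>\<perp>\<close>. A hyperplane misses \<open>2\<^bsup>n-1\<^esup>\<close> points, so each family has
  \<open>2 ^ 2\<^bsup>n-1\<^esup>\<close> members, while two distinct hyperplanes jointly miss only \<open>2\<^bsup>n-2\<^esup>\<close> points, so two
  families share only \<open>2 ^ 2\<^bsup>n-2\<^esup>\<close> members. The union bound and Bonferroni's inequality therefore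
  agree up to a relative error of at most \<open>2\<^sup>n / 2 ^ 2\<^bsup>n-2\<^esup>\<close>.\<close>

section \<open>Counting supersets, and a Bonferroni bound\<close>

lemma card_supersets:
  assumes "finite V" "P \<subseteq> V"
  shows "card {S. P \<subseteq> S \<and> S \<subseteq> V} = 2 ^ card (V - P)"
proof -
  have "bij_betw (\<lambda>T. P \<union> T) (Pow (V - P)) {S. P \<subseteq> S \<and> S \<subseteq> V}"
    by (rule bij_betw_byWitness[where f' = "\<lambda>S. S - P"]) (use assms in auto)
  then show ?thesis
    using assms by (simp add: bij_betw_same_card[symmetric] card_Pow)
qed

text \<open>Each element of \<open>A i\<close> lies either in \<open>A i\<close> alone or in
  \<open>A i \<inter> A j\<close> for some other \<open>j\<close>, and the exclusive parts
  \<open>B i\<close> are disjoint subsets of the union. The double sum runs over ordered pairs, so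
  the correction is twice that of the classical inequality; this costs nothing
  asymptotically.\<close>

lemma bonferroni_lower:
  fixes A :: "'i \<Rightarrow> 'a set"
  assumes "finite I" "\<And>i. i \<in> I \<Longrightarrow> finite (A i)"
  shows "(\<Sum>i\<in>I. card (A i)) \<le> card (\<Union>i\<in>I. A i) + (\<Sum>i\<in>I. \<Sum>j\<in>I - {i}. card (A i \<inter> A j))"
proof -
  define B where "B i = A i - (\<Union>j\<in>I - {i}. A j)" for i
  have "card (A i) \<le> card (B i) + (\<Sum>j\<in>I - {i}. card (A i \<inter> A j))" if "i \<in> I" for i
  proof -
    have "A i \<subseteq> B i \<union> (\<Union>j\<in>I - {i}. A i \<inter> A j)"
      by (auto simp: B_def)
    moreover have "finite (B i \<union> (\<Union>j\<in>I - {i}. A i \<inter> A j))"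
      using assms that by (auto simp: B_def)
    ultimately have "card (A i) \<le> card (B i \<union> (\<Union>j\<in>I - {i}. A i \<inter> A j))"
      by (rule card_mono[rotated])
    also have "\<dots> \<le> card (B i) + card (\<Union>j\<in>I - {i}. A i \<inter> A j)"
      by (rule card_Un_le)
    also have "card (\<Union>j\<in>I - {i}. A i \<inter> A j) \<le> (\<Sum>j\<in>I - {i}. card (A i \<inter> A j))"
      using assms by (intro card_UN_le) auto
    finally show ?thesis by simp
  qed
  then have "(\<Sum>i\<in>I. card (A i)) \<le> (\<Sum>i\<in>I. card (B i)) + (\<Sum>i\<in>I. \<Sum>j\<in>I - {i}. card (A i \<inter> A j))"
    by (simp add: sum_mono flip: sum.distrib)
  moreover have "(\<Sum>i\<in>I. card (B i)) = card (\<Union>i\<in>I. B i)"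
    using assms by (intro card_UN_disjoint[symmetric]) (auto simp: B_def)
  moreover have "card (\<Union>i\<in>I. B i) \<le> card (\<Union>i\<in>I. A i)"
    using assms by (intro card_mono) (auto simp: B_def)
  ultimately show ?thesis by linarith
qed

section \<open>Points off one or two hyperplanes\<close>

lemma bij_betw_carrier_vec_bit:
  "bij_betw (\<lambda>S. vec n (\<lambda>i. of_bool (i \<in> S) :: bit)) (Pow {..<n}) (carrier_vec n)"
  by (rule bij_betw_byWitness[where f' = "\<lambda>v. {i. i < n \<and> v $ i = 1}"]) auto

lemma finite_carrier_vec_bit: "finite (carrier_vec n :: bit vec set)"
  using bij_betw_finite[OF bij_betw_carrier_vec_bit] by simp

lemma card_carrier_vec_bit: "card (carrier_vec n :: bit vec set) = 2 ^ n"
  using bij_betw_same_card[OF bij_betw_carrier_vec_bit, of n] by (simp add: card_Pow)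

text \<open>In characteristic two, translation by \<open>a\<close> is an involution of
  \<open>P\<close>, and \<open>a \<bullet> w = 1\<close> makes it swap the two values of
  \<open>x \<bullet> w\<close>. A general \<open>P\<close> lets the halving be iterated.\<close>

lemma double_card_if_translation_invariant:
  fixes P :: "bit vec set"
  assumes P: "P \<subseteq> carrier_vec n" and w: "w \<in> carrier_vec n" and a: "a \<in> carrier_vec n"
    and inv: "\<And>x. x \<in> P \<Longrightarrow> x + a \<in> P" and aw: "a \<bullet> w = 1"
  shows "2 * card {x \<in> P. x \<bullet> w = 1} = card P"
proof -
  have fin: "finite P"
    using P finite_carrier_vec_bit finite_subset by blast
  have invol: "x + a + a = x" if "x \<in> P" for x
    using that P a by (intro eq_vecI) (auto simp: add.assoc simp del: add_bit_eq_xor)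
  have flip: "(x + a) \<bullet> w = x \<bullet> w + 1" if "x \<in> P" for x
    using that P a w aw by (subst add_scalar_prod_distrib[of _ n]) auto
  have "bij_betw (\<lambda>x. x + a) {x \<in> P. x \<bullet> w = 1} {x \<in> P. x \<bullet> w = 0}"
    by (rule bij_betw_byWitness[where f' = "\<lambda>x. x + a"]) (auto simp: invol flip inv)
  then have "card {x \<in> P. x \<bullet> w = 1} = card {x \<in> P. x \<bullet> w = 0}"
    by (rule bij_betw_same_card)
  moreover have "P = {x \<in> P. x \<bullet> w = 1} \<union> {x \<in> P. x \<bullet> w = 0}"
    by auto
  then have "card P = card {x \<in> P. x \<bullet> w = 1} + card {x \<in> P. x \<bullet> w = 0}"
    using fin by (subst card_Un_disjoint[symmetric]) auto
  ultimately show ?thesis by simp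
qed

lemma nonzero_bit_vecE:
  fixes w :: "bit vec"
  assumes "w \<in> carrier_vec n" "w \<noteq> 0\<^sub>v n"
  obtains j where "j < n" "w $ j = 1"
  using assms by (metis bit_not_one_iff carrier_vecD eq_vecI index_zero_vec)

text \<open>Over a two-element field the span of \<open>v\<close> is only \<open>0\<close> and
  \<open>v\<close>, so \<open>w\<close> lies outside it and some functional kills \<open>v\<close>
  but not \<open>w\<close>. Allowing \<open>v\<close> to be zero covers the case of a single
  hyperplane as well.\<close>

lemma separating_vecE:
  fixes v w :: "bit vec"
  assumes v: "v \<in> carrier_vec n" and w: "w \<in> carrier_vec n" and "w \<noteq> 0\<^sub>v n" "v \<noteq> w"
  obtains a where "a \<in> carrier_vec n" "a \<bullet> v = 0" "a \<bullet> w = 1"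
proof -
  obtain j where j: "j < n" "w $ j = 1"
    using assms nonzero_bit_vecE by blast
  obtain i where i: "i < n" "v $ i \<noteq> w $ i"
    using v w \<open>v \<noteq> w\<close> by (metis carrier_vecD eq_vecI)
  \<comment> \<open>A single unit vector separates in the first two cases. In the last, the sum of
    both works: it pairs with \<open>v\<close> to 1 + 1 = 0 and with \<open>w\<close> to 0 + 1 =
    1.\<close>
  consider "v $ j = 0" | "w $ i = 1" "v $ i = 0" | "v $ j = 1" "v $ i = 1" "w $ i = 0"
    using i by (metis bit_not_one_iff)
  then show thesis
  proof cases
    case 1
    then show ?thesis
      using that[of "unit_vec n j"] v w j by (simp add: scalar_prod_left_unit)
  next
    case 2
    then show ?thesis
      using that[of "unit_vec n i"] v w i by (simp add: scalar_prod_left_unit)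
  next
    case 3
    then show ?thesis
      using that[of "unit_vec n i + unit_vec n j"] v w i j
      by (simp add: scalar_prod_left_unit add_scalar_prod_distrib[of _ n])
  qed
qed

lemma double_card_off_perp:
  fixes v :: "bit vec"
  assumes v: "v \<in> carrier_vec n" "v \<noteq> 0\<^sub>v n"
  shows "2 * card {x \<in> carrier_vec n. x \<bullet> v = 1} = 2 ^ n"
proof -
  obtain a where "a \<in> carrier_vec n" "a \<bullet> v = 1"
    using separating_vecE[of "0\<^sub>v n" n v] v by auto
  then show ?thesis
    using double_card_if_translation_invariant[of "carrier_vec n" n v a] v
    by (simp add: card_carrier_vec_bit)
qed

text \<open>Two successive halvings: a translation by \<open>a\<close> with
  \<open>a \<bullet> v = 0\<close> preserves the complement of the first hyperplane, so the second
  hyperplane splits that complement evenly.\<close>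

lemma quadruple_card_off_perps:
  fixes v w :: "bit vec"
  assumes v: "v \<in> carrier_vec n" "v \<noteq> 0\<^sub>v n" and w: "w \<in> carrier_vec n" "w \<noteq> 0\<^sub>v n" and "v \<noteq> w"
  shows "4 * card {x \<in> carrier_vec n. x \<bullet> v = 1 \<and> x \<bullet> w = 1} = 2 ^ n"
proof -
  obtain a where a: "a \<in> carrier_vec n" "a \<bullet> v = 0" "a \<bullet> w = 1"
    using assms separating_vecE by blast
  have "2 * card {x \<in> {x \<in> carrier_vec n. x \<bullet> v = 1}. x \<bullet> w = 1}
      = card {x \<in> carrier_vec n. x \<bullet> v = 1}"
    using a v w
    by (intro double_card_if_translation_invariant[of _ n w a])
       (auto simp: add_scalar_prod_distrib[of _ n])
  then show ?thesis
    using double_card_off_perp[OF v] by (simp add: conj_assoc)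
qed

section \<open>The families of supersets and the size of their union\<close>

definition perp_supersets :: "nat \<Rightarrow> bit vec \<Rightarrow> bit vec set set" where
  "perp_supersets n v = {S. perp n v \<subseteq> S \<and> S \<subseteq> carrier_vec n}"

lemma finite_perp_supersets: "finite (perp_supersets n v)"
  using finite_carrier_vec_bit[of n]
  by (auto simp: perp_supersets_def intro: finite_subset[of _ "Pow (carrier_vec n)"])

lemma card_perp_supersets:
  assumes v: "v \<in> carrier_vec n" "v \<noteq> 0\<^sub>v n"
  shows "card (perp_supersets n v) = 2 ^ 2 ^ (n - 1)"
proof -
  \<comment> \<open>Dimension 0 has no nonzero vector, so the truncated \<open>n - 1\<close> is a
    true predecessor.\<close>
  have "n \<noteq> 0"
    using v by (auto intro: eq_vecI)
  have "carrier_vec n - perp n v = {x \<in> carrier_vec n. x \<bullet> v = 1}"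
    by (auto simp: perp_def)
  moreover have "card {x \<in> carrier_vec n. x \<bullet> v = 1} = 2 ^ (n - 1)"
    using double_card_off_perp[OF v] \<open>n \<noteq> 0\<close> by (cases n) auto
  ultimately show ?thesis
    using card_supersets[OF finite_carrier_vec_bit, of "perp n v" n]
    by (simp add: perp_supersets_def perp_def)
qed

lemma card_perp_supersets_Int:
  assumes "n \<ge> 2"
    and v: "v \<in> carrier_vec n" "v \<noteq> 0\<^sub>v n" and w: "w \<in> carrier_vec n" "w \<noteq> 0\<^sub>v n" and "v \<noteq> w"
  shows "card (perp_supersets n v \<inter> perp_supersets n w) = 2 ^ 2 ^ (n - 2)"
proof -
  have off: "carrier_vec n - (perp n v \<union> perp n w) = {x \<in> carrier_vec n. x \<bullet> v = 1 \<and> x \<bullet> w = 1}"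
    by (auto simp: perp_def)
  have "(2::nat) ^ n = 4 * 2 ^ (n - 2)"
    using \<open>n \<ge> 2\<close> by (auto simp: le_iff_add power_add)
  then have "card {x \<in> carrier_vec n. x \<bullet> v = 1 \<and> x \<bullet> w = 1} = 2 ^ (n - 2)"
    using quadruple_card_off_perps[OF v w \<open>v \<noteq> w\<close>] by linarith
  moreover have "perp_supersets n v \<inter> perp_supersets n w
      = {S. perp n v \<union> perp n w \<subseteq> S \<and> S \<subseteq> carrier_vec n}"
    by (auto simp: perp_supersets_def)
  ultimately show ?thesis
    using card_supersets[OF finite_carrier_vec_bit, of "perp n v \<union> perp n w" n]
    by (simp add: off) (auto simp: perp_def)
qed

lemma \<H>_eq_UN_perp_supersets:
  assumes "n \<ge> 1"
  shows "\<H> n = (\<Union>v\<in>carrier_vec n - {0\<^sub>v n}. perp_supersets n v)"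
proof -
  have "unit_vec n 0 \<in> carrier_vec n - {0\<^sub>v n :: bit vec}"
    using assms by simp
  moreover have "perp n w \<subseteq> perp n (0\<^sub>v n)" for w
    by (auto simp: perp_def)
  ultimately show ?thesis
    unfolding \<H>_def perp_supersets_def by blast
qed

lemma card_nonzero_bit_vecs: "card (carrier_vec n - {0\<^sub>v n :: bit vec}) = 2 ^ n - 1"
  by (simp add: card_carrier_vec_bit)

lemma card_\<H>_le:
  assumes "n \<ge> 1"
  shows "card (\<H> n) \<le> (2 ^ n - 1) * 2 ^ 2 ^ (n - 1)"
proof -
  have "card (\<H> n) \<le> (\<Sum>v\<in>carrier_vec n - {0\<^sub>v n}. card (perp_supersets n v))"
    unfolding \<H>_eq_UN_perp_supersets[OF assms]
    by (intro card_UN_le) (simp add: finite_carrier_vec_bit)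
  then show ?thesis
    by (simp add: card_perp_supersets card_nonzero_bit_vecs)
qed

lemma card_\<H>_ge:
  assumes "n \<ge> 2"
  shows "(2 ^ n - 1) * 2 ^ 2 ^ (n - 1) \<le> card (\<H> n) + (2 ^ n - 1) * (2 ^ n * 2 ^ 2 ^ (n - 2))"
proof -
  let ?I = "carrier_vec n - {0\<^sub>v n :: bit vec}"
  let ?A = "perp_supersets n"
  have "(2 ^ n - 1) * 2 ^ 2 ^ (n - 1) = (\<Sum>v\<in>?I. card (?A v))"
    by (simp add: card_perp_supersets card_nonzero_bit_vecs)
  also have "\<dots> \<le> card (\<H> n) + (\<Sum>v\<in>?I. \<Sum>w\<in>?I - {v}. card (?A v \<inter> ?A w))"
    using bonferroni_lower[of ?I ?A] assms
    by (simp add: \<H>_eq_UN_perp_supersets finite_carrier_vec_bit finite_perp_supersets)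
  also have "(\<Sum>v\<in>?I. \<Sum>w\<in>?I - {v}. card (?A v \<inter> ?A w)) \<le> (\<Sum>v\<in>?I. 2 ^ n * 2 ^ 2 ^ (n - 2))"
  proof (rule sum_mono)
    fix v assume v: "v \<in> ?I"
    have "(\<Sum>w\<in>?I - {v}. card (?A v \<inter> ?A w)) = (\<Sum>w\<in>?I - {v}. 2 ^ 2 ^ (n - 2))"
      using v assms by (intro sum.cong refl card_perp_supersets_Int) auto
    also have "\<dots> = card (?I - {v}) * 2 ^ 2 ^ (n - 2)"
      by simp
    \<comment> \<open>This crude bound already suffices, since the intersections are doubly
      exponentially smaller than the families.\<close>
    also have "card (?I - {v}) \<le> 2 ^ n"
      using card_mono[of "carrier_vec n" "?I - {v}"]
      by (auto simp: finite_carrier_vec_bit card_carrier_vec_bit)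
    finally show "(\<Sum>w\<in>?I - {v}. card (?A v \<inter> ?A w)) \<le> 2 ^ n * 2 ^ 2 ^ (n - 2)"
      by simp
  qed
  also have "(\<Sum>v\<in>?I. 2 ^ n * 2 ^ 2 ^ (n - 2)) = (2 ^ n - 1 :: nat) * (2 ^ n * 2 ^ 2 ^ (n - 2))"
    by (simp only: sum_constant card_nonzero_bit_vecs of_nat_id)
  finally show ?thesis by simp
qed

section \<open>Asymptotics\<close>

lemma pow_over_double_pow_tendsto_0: "(\<lambda>n. 2 ^ n / 2 ^ 2 ^ (n - 2) :: real) \<longlonglongrightarrow> 0"
proof -
  have lim: "(\<lambda>k. real k / 2 ^ k) \<longlonglongrightarrow> 0"
    using lim_n_over_pown[of "2::real"] by simp
  \<comment> \<open>Substitute \<open>k = 2 ^ n\<close> in the limit of \<open>k / 2 ^ k\<close>.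
    Shifting the index by 2 then produces the factor 4 and removes the truncated
    subtraction.\<close>
  have "filterlim (\<lambda>n. 2 ^ n :: nat) at_top sequentially"
    by (rule filterlim_subseq) (auto simp: strict_mono_def)
  from filterlim_compose[OF lim this] have "(\<lambda>n. 2 ^ n / 2 ^ 2 ^ n :: real) \<longlonglongrightarrow> 0"
    by simp
  from tendsto_mult_left[OF this, of 4]
  have "(\<lambda>n. 2 ^ (n + 2) / 2 ^ 2 ^ (n + 2 - 2) :: real) \<longlonglongrightarrow> 0"
    by simp
  then show ?thesis
    by (rule LIMSEQ_offset)
qed

theorem theorem4p1:
  "(\<lambda>n. real (card (\<H> n))) \<sim>[at_top] (\<lambda>n. 2 ^ (2 ^ (n - 1)) * (2 ^ n - 1))"
proof (rule asymp_equivI'[OF tendsto_sandwich])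
  have bounds: "1 - 2 ^ n / 2 ^ 2 ^ (n - 2) \<le> real (card (\<H> n)) / (2 ^ 2 ^ (n - 1) * (2 ^ n - 1))"
    "real (card (\<H> n)) / (2 ^ 2 ^ (n - 1) * (2 ^ n - 1)) \<le> 1" if "n \<ge> 2" for n :: nat
  proof -
    define N :: real where "N = 2 ^ n - 1"
    define L :: real where "L = 2 ^ 2 ^ (n - 2)"
    have "2 ^ 1 < (2 ^ n :: real)"
      using that by (intro power_strict_increasing) auto
    then have pos: "N > 0" "L > 0"
      by (auto simp: N_def L_def)
    \<comment> \<open>A family has \<open>L * L\<close> members and a pairwise intersection
      \<open>L\<close>, so after division by the main term \<open>N * (L * L)\<close> the error is
      \<open>2 ^ n / L\<close>.\<close>
    have "(2::nat) ^ (n - 1) = 2 ^ (n - 2) + 2 ^ (n - 2)"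
      using that by (auto simp: le_iff_add)
    then have sq: "(2::real) ^ 2 ^ (n - 1) = L * L"
      by (simp add: L_def power_add)
    have N: "real (2 ^ n - Suc 0) = N"
      by (simp add: N_def of_nat_diff)
    have "real ((2 ^ n - 1) * 2 ^ 2 ^ (n - 1))
        \<le> real (card (\<H> n) + (2 ^ n - 1) * (2 ^ n * 2 ^ 2 ^ (n - 2)))"
      using card_\<H>_ge[OF that] by (rule of_nat_mono)
    then have "N * (L * L) \<le> real (card (\<H> n)) + N * (2 ^ n * L)"
      by (simp add: N sq[simplified] del: of_nat_diff flip: L_def)
    then have "(N * (L * L) - N * (2 ^ n * L)) / (L * L * N) \<le> real (card (\<H> n)) / (L * L * N)"
      using pos by (intro divide_right_mono) auto
    moreover have "(N * (L * L) - N * (2 ^ n * L)) / (L * L * N) = 1 - 2 ^ n / L"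
      using pos by (simp add: field_simps)
    ultimately show "1 - 2 ^ n / 2 ^ 2 ^ (n - 2)
        \<le> real (card (\<H> n)) / (2 ^ 2 ^ (n - 1) * (2 ^ n - 1))"
      unfolding sq L_def[symmetric] N_def[symmetric] by simp
    have "real (card (\<H> n)) \<le> real ((2 ^ n - 1) * 2 ^ 2 ^ (n - 1))"
      using card_\<H>_le[of n] that by (intro of_nat_mono) auto
    then have "real (card (\<H> n)) \<le> N * (L * L)"
      by (simp add: N sq[simplified] del: of_nat_diff)
    then show "real (card (\<H> n)) / (2 ^ 2 ^ (n - 1) * (2 ^ n - 1)) \<le> 1"
      using pos unfolding sq N_def[symmetric] by (simp add: field_simps)
  qed
  show "\<forall>\<^sub>F n in at_top. 1 - 2 ^ n / 2 ^ 2 ^ (n - 2)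
      \<le> real (card (\<H> n)) / (2 ^ 2 ^ (n - 1) * (2 ^ n - 1))"
    using bounds(1) by (rule eventually_at_top_linorderI)
  show "\<forall>\<^sub>F n in at_top. real (card (\<H> n)) / (2 ^ 2 ^ (n - 1) * (2 ^ n - 1)) \<le> 1"
    using bounds(2) by (rule eventually_at_top_linorderI)
  show "(\<lambda>n. 1 - 2 ^ n / 2 ^ 2 ^ (n - 2) :: real) \<longlonglongrightarrow> 1"
    using tendsto_diff[OF tendsto_const[of 1] pow_over_double_pow_tendsto_0] by simp
\<comment> \<open>What remains is the limit of the constant upper bound 1.\<close>
qed simp

end
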